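(* Let $\mathcal{L}$ be a square-integrable $\mathcal{H}$-valued Lévy process with non-decreasing paths, and denote the covariance operator of its continuous martingale part by $\mathbb{Q}^0_{\mathcal{L}}$. Let $\mathcal{T}$ be a symmetric Hilbert-Schmidt operator on $H$. Then $\mathbb{Q}^0_{\mathcal{L}}\mathcal{T}=0$, that is, $\mathcal{T}\in\ker(\mathbb{Q}^0_{\mathcal{L}})$.
   Context: $H$ is a real separable Hilbert space with inner product $(\cdot,\cdot)_H$, and $\mathcal{H}=L_{\mathrm{HS}}(H)$ is the separable Hilbert space of Hilbert-Schmidt operators on $H$, with inner product $\langle\cdot,\cdot\rangle_{\mathcal{H}}$. An $\mathcal{H}$-valued Lévy process $\mathcal{L}$ has non-decreasing paths if $\mathcal{L}(t)$ is self-adjoint and $t\mapsto(\mathcal{L}(t)f,f)_H$ is non-decreasing in $t\geq0$ for every $f\in H$, almost surely. The operator $\mathbb{Q}^0_{\mathcal{L}}$ (self-adjoint, non-negative definite, trace class on $\mathcal{H}$) is the Gaussian covariance in the Lévy-Khintchine representation $\mathbb{E}[\exp(\mathrm{i}\langle\mathcal{L}(t),\mathcal{T}\rangle_{\mathcal{H}})]=\exp(t\Psi_{\mathcal{L}}(\mathcal{T}))$, where $$\Psi_{\mathcal{L}}(\mathcal{T})=\mathrm{i}\langle\mathcal{D},\mathcal{T}\rangle_{\mathcal{H}}-\tfrac12\langle\mathbb{Q}_{\mathcal{L}}^0\mathcal{T},\mathcal{T}\rangle_{\mathcal{H}}+\int_{\mathcal{H}}\left(e^{\mathrm{i}\langle\mathcal{Z},\mathcal{T}\rangle_{\mathcal{H}}}-1-\mathrm{i}\mathbf{1}_{\|\mathcal{Z}\|_{\mathcal{H}}\leq1}\langle\mathcal{Z},\mathcal{T}\rangle_{\mathcal{H}}\right)\nu(d\mathcal{Z}),$$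 with drift $\mathcal{D}\in\mathcal{H}$ and Lévy measure $\nu$ on $\mathcal{H}$. *)

theory Defs
  imports "HOL-Probability.Probability"
begin

class separable_hilbert_space = real_inner + banach + polish_space

definition orthonormal :: "'a::real_inner set \<Rightarrow> bool" where
  "orthonormal B \<longleftrightarrow> pairwise orthogonal B \<and> (\<forall>e\<in>B. norm e = 1)"

definition orthonormal_basis :: "'a::real_inner set \<Rightarrow> bool" where
  "orthonormal_basis B \<longleftrightarrow> orthonormal B \<and> closure (span B) = UNIV"

lemma has_sum_finite_sum:
  fixes f :: "'i \<Rightarrow> 'b \<Rightarrow> real"
  assumes "finite I" "\<And>i. i \<in> I \<Longrightarrow> (f i has_sum s i) A"
  shows "((\<lambda>x. \<Sum>i\<in>I. f i x) has_sum (\<Sum>i\<in>I. s i)) A"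
  using assms by induction (auto intro!: has_sum_add)

lemma orthonormal_inner:
  assumes "orthonormal B" "e \<in> B" "f \<in> B"
  shows "inner e f = (if e = f then 1 else 0)"
  using assms by (auto simp: orthonormal_def pairwise_def orthogonal_def norm_eq_1)

lemma orthonormal_subset: "orthonormal B \<Longrightarrow> A \<subseteq> B \<Longrightarrow> orthonormal A"
  by (auto simp: orthonormal_def pairwise_def)

lemma inner_orthonormal_sum:
  assumes "finite F" "orthonormal F" "f \<in> F"
  shows "inner f (\<Sum>e\<in>F. c e *\<^sub>R e) = c f"
proof -
  have "inner f (\<Sum>e\<in>F. c e *\<^sub>R e) = (\<Sum>e\<in>F. if f = e then c e else 0)"
    unfolding inner_sum_right
    using assms orthonormal_inner[OF assms(2,3)] by (intro sum.cong) auto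
  then show ?thesis using assms by simp
qed

lemma norm_orthonormal_sum:
  assumes "finite F" "orthonormal F"
  shows "(norm (\<Sum>e\<in>F. c e *\<^sub>R e))\<^sup>2 = (\<Sum>e\<in>F. (c e)\<^sup>2)"
  unfolding power2_norm_eq_inner inner_sum_left
  using inner_orthonormal_sum[OF assms] by (intro sum.cong) (auto simp: power2_eq_square)

lemma norm_diff_orthonormal_sum:
  assumes "finite F" "orthonormal F"
  shows "(norm (x - (\<Sum>e\<in>F. c e *\<^sub>R e)))\<^sup>2
    = (norm x)\<^sup>2 - (\<Sum>e\<in>F. (inner x e)\<^sup>2) + (\<Sum>e\<in>F. (c e - inner x e)\<^sup>2)"
proof -
  have "(norm (x - (\<Sum>e\<in>F. c e *\<^sub>R e)))\<^sup>2
      = (norm x)\<^sup>2 + (norm (\<Sum>e\<in>F. c e *\<^sub>R e))\<^sup>2 - 2 * (\<Sum>e\<in>F. c e * inner x e)"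
    by (simp add: power2_norm_eq_inner inner_diff inner_commute inner_sum_right)
  then show ?thesis
    by (simp add: norm_orthonormal_sum[OF assms] power2_diff sum.distrib sum_subtractf
        sum_distrib_left mult.assoc)
qed

lemma bessel:
  assumes "finite F" "orthonormal F"
  shows "(\<Sum>e\<in>F. (inner x e)\<^sup>2) \<le> (norm x)\<^sup>2"
  using norm_diff_orthonormal_sum[OF assms, of x "\<lambda>e. inner x e"]
  by simp (metis diff_ge_0_iff_ge zero_le_power2)

lemma orthonormal_basis_finite_approx:
  assumes "orthonormal_basis B" "0 < \<epsilon>"
  obtains F where "finite F" "F \<subseteq> B"
    "\<And>G. finite G \<Longrightarrow> F \<subseteq> G \<Longrightarrow> G \<subseteq> B \<Longrightarrow> norm (x - (\<Sum>e\<in>G. inner x e *\<^sub>R e)) < \<epsilon>"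
proof -
  have "x \<in> closure (span B)" using assms(1) by (simp add: orthonormal_basis_def)
  then obtain y where y: "y \<in> span B" "dist y x < \<epsilon>"
    using assms(2) by (auto simp: closure_approachable)
  obtain F r where F: "finite F" "F \<subseteq> B" "y = (\<Sum>e\<in>F. r e *\<^sub>R e)"
    using y(1) unfolding span_explicit by auto
  have "norm (x - (\<Sum>e\<in>G. inner x e *\<^sub>R e)) < \<epsilon>" if G: "finite G" "F \<subseteq> G" "G \<subseteq> B" for G
  proof -
    have o: "orthonormal G"
      using assms(1) G orthonormal_subset orthonormal_basis_def by blast
    define c where "c e = (if e \<in> F then r e else 0)" for e
    have "y = (\<Sum>e\<in>G. c e *\<^sub>R e)"
      unfolding F(3) c_def using G F by (intro sum.mono_neutral_cong_left) auto
    moreover have "(norm (x - (\<Sum>e\<in>G. inner x e *\<^sub>R e)))\<^sup>2 \<le> (norm (x - (\<Sum>e\<in>G. c e *\<^sub>R e)))\<^sup>2"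
      unfolding norm_diff_orthonormal_sum[OF G(1) o] by (simp add: sum_nonneg)
    ultimately have "norm (x - (\<Sum>e\<in>G. inner x e *\<^sub>R e)) \<le> norm (x - y)"
      using power2_le_imp_le by auto
    then show ?thesis using y(2) by (simp add: dist_norm norm_minus_commute)
  qed
  with F that show thesis by blast
qed

lemma has_sum_orthonormal_basis:
  assumes "orthonormal_basis B"
  shows "((\<lambda>e. inner x e *\<^sub>R e) has_sum x) B"
  unfolding has_sum_def
proof (rule tendstoI)
  fix \<epsilon> :: real assume "0 < \<epsilon>"
  obtain F where F: "finite F" "F \<subseteq> B"
    "\<And>G. finite G \<Longrightarrow> F \<subseteq> G \<Longrightarrow> G \<subseteq> B \<Longrightarrow> norm (x - (\<Sum>e\<in>G. inner x e *\<^sub>R e)) < \<epsilon>"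
    using orthonormal_basis_finite_approx[OF assms \<open>0 < \<epsilon>\<close>] by metis
  show "\<forall>\<^sub>F G in finite_subsets_at_top B. dist (\<Sum>e\<in>G. inner x e *\<^sub>R e) x < \<epsilon>"
    unfolding eventually_finite_subsets_at_top dist_norm using F
    by (intro exI[of _ F]) (auto simp: norm_minus_commute)
qed

lemma parseval:
  assumes "orthonormal_basis B"
  shows "((\<lambda>e. (inner x e)\<^sup>2) has_sum (norm x)\<^sup>2) B"
proof -
  have "((\<lambda>e. inner x (inner x e *\<^sub>R e)) has_sum inner x x) B"
    by (intro has_sum_bounded_linear[OF bounded_linear_inner_right]
        has_sum_orthonormal_basis[OF assms])
  then show ?thesis by (simp add: power2_eq_square dot_square_norm)
qed

text \<open>Gram--Schmidt on a dense sequence gives a countable orthonormal basis.\<close>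

definition gs_step :: "'a::real_inner set \<Rightarrow> 'a \<Rightarrow> 'a set" where
  "gs_step S x = (if x \<in> span S then S else insert (sgn (x - (\<Sum>e\<in>S. inner x e *\<^sub>R e))) S)"

lemma gs_step:
  assumes "finite S" "orthonormal S"
  shows "finite (gs_step S x)" "orthonormal (gs_step S x)" "x \<in> span (gs_step S x)"
proof -
  define r where "r = x - (\<Sum>e\<in>S. inner x e *\<^sub>R e)"
  have sm: "(\<Sum>e\<in>S. inner x e *\<^sub>R e) \<in> span S"
    by (intro span_sum span_scale span_base)
  show "finite (gs_step S x)" using assms by (auto simp: gs_step_def)
  have "r \<noteq> 0" if "x \<notin> span S" using that sm unfolding r_def by auto
  moreover have "inner e r = 0" if "e \<in> S" for e
    using inner_orthonormal_sum[OF assms that, of "inner x"]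
    by (simp add: r_def inner_diff inner_commute)
  ultimately show "orthonormal (gs_step S x)"
    using assms(2) unfolding gs_step_def r_def[symmetric]
    by (auto simp: orthonormal_def pairwise_insert orthogonal_def sgn_div_norm inner_commute)
  show "x \<in> span (gs_step S x)"
  proof (cases "x \<in> span S")
    case True then show ?thesis by (simp add: gs_step_def)
  next
    case False
    have "norm r *\<^sub>R sgn r \<in> span (insert (sgn r) S)" by (intro span_scale span_base) simp
    then have "r \<in> span (insert (sgn r) S)" by (cases "r = 0") (simp_all add: sgn_div_norm span_zero)
    moreover have "(\<Sum>e\<in>S. inner x e *\<^sub>R e) \<in> span (insert (sgn r) S)"
      using sm span_mono[of S "insert (sgn r) S"] by auto
    ultimately have "r + (\<Sum>e\<in>S. inner x e *\<^sub>R e) \<in> span (insert (sgn r) S)" by (rule span_add)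
    then show ?thesis using False by (simp add: gs_step_def r_def)
  qed
qed

lemma ex_countable_orthonormal_basis:
  "\<exists>B::'a::{real_inner, second_countable_topology} set. orthonormal_basis B \<and> countable B"
proof -
  obtain D :: "'a set" where D: "countable D" "\<And>X. open X \<Longrightarrow> X \<noteq> {} \<Longrightarrow> \<exists>d\<in>D. d \<in> X"
    by (rule countable_dense_setE) auto
  have "D \<noteq> {}" using D(2)[of UNIV] by auto
  then obtain d :: "nat \<Rightarrow> 'a" where d: "range d = D"
    using D(1) by (metis range_from_nat_into)
  define S where "S = rec_nat {} (\<lambda>n S. gs_step S (d n))"
  have S0: "S 0 = {}" and SS: "\<And>n. S (Suc n) = gs_step (S n) (d n)" by (simp_all add: S_def)
  have S: "finite (S n) \<and> orthonormal (S n)" for n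
  proof (induction n)
    case 0 show ?case by (simp add: S0 orthonormal_def)
  next
    case (Suc n) then show ?case unfolding SS using gs_step by blast
  qed
  have mono: "S m \<subseteq> S n" if "m \<le> n" for m n
    using that by (rule lift_Suc_mono_le[rotated]) (auto simp: SS gs_step_def)
  define B where "B = (\<Union>n. S n)"
  have "orthonormal B"
    unfolding orthonormal_def pairwise_def
  proof (intro conjI ballI impI)
    fix x y assume xy: "x \<in> B" "y \<in> B" "x \<noteq> y"
    then obtain m n where "x \<in> S m" "y \<in> S n" by (auto simp: B_def)
    then have "x \<in> S (max m n)" "y \<in> S (max m n)"
      using mono[of m "max m n"] mono[of n "max m n"] by auto
    then show "orthogonal x y" using S[of "max m n"] xy(3) by (auto simp: orthonormal_def pairwise_def)
  next
    fix x assume "x \<in> B"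
    then show "norm x = 1" using S by (auto simp: B_def orthonormal_def)
  qed
  moreover have "D \<subseteq> span B"
  proof -
    have "d n \<in> span B" for n
    proof -
      have "d n \<in> span (S (Suc n))" using gs_step(3)[of "S n" "d n"] S[of n] by (simp add: SS)
      moreover have "S (Suc n) \<subseteq> B" unfolding B_def by blast
      ultimately show ?thesis using span_mono by blast
    qed
    then show ?thesis using d by auto
  qed
  moreover have "closure D = UNIV"
  proof (rule ccontr)
    assume "closure D \<noteq> UNIV"
    then obtain e where "e \<in> D" "e \<in> - closure D"
      using D(2)[of "- closure D"] by auto
    then show False using closure_subset by auto
  qed
  ultimately have "orthonormal_basis B"
    unfolding orthonormal_basis_def using closure_mono[of D "span B"] by auto
  moreover have "countable B"
    unfolding B_def using S by (intro countable_UN) (auto intro: countable_finite)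
  ultimately show ?thesis by blast
qed

definition hilbert_schmidt :: "('a::real_inner \<Rightarrow> 'a) \<Rightarrow> bool" where
  "hilbert_schmidt T \<longleftrightarrow> bounded_linear T \<and>
     (\<exists>B. orthonormal_basis B \<and> (\<lambda>e. (norm (T e))\<^sup>2) summable_on B)"

lemma sum_square_functional_le:
  fixes \<phi> :: "'a::real_inner \<Rightarrow> real"
  assumes A: "orthonormal_basis A" and F: "finite F" "orthonormal F"
    and \<phi>: "bounded_linear \<phi>" "(\<lambda>e. (\<phi> e)\<^sup>2) summable_on A"
  shows "(\<Sum>b\<in>F. (\<phi> b)\<^sup>2) \<le> (\<Sum>\<^sub>\<infinity>e\<in>A. (\<phi> e)\<^sup>2)"
proof -
  interpret \<phi>: bounded_linear \<phi> by fact
  define x where "x = (\<Sum>b\<in>F. \<phi> b *\<^sub>R b)"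
  define s where "s = (\<Sum>b\<in>F. (\<phi> b)\<^sup>2)"
  define q where "q = (\<Sum>\<^sub>\<infinity>e\<in>A. (\<phi> e)\<^sup>2)"
  have q0: "0 \<le> q" unfolding q_def by (intro infsum_nonneg) auto
  have s0: "0 \<le> s" unfolding s_def by (intro sum_nonneg) auto
  have \<phi>x: "\<phi> x = s" by (simp add: x_def s_def \<phi>.sum \<phi>.scaleR power2_eq_square)
  have nx: "(norm x)\<^sup>2 = s" unfolding x_def s_def by (rule norm_orthonormal_sum[OF F])
  have "((\<lambda>e. \<phi> (inner x e *\<^sub>R e)) has_sum \<phi> x) A"
    by (intro has_sum_bounded_linear[OF \<phi>(1)] has_sum_orthonormal_basis[OF A])
  then have "((\<lambda>e. inner x e * \<phi> e) has_sum \<phi> x) A" by (simp add: \<phi>.scaleR)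
  moreover have "((\<lambda>e. (1/2) * ((inner x e)\<^sup>2 + (\<phi> e)\<^sup>2)) has_sum (1/2) * (s + q)) A"
    using has_sum_cmult_right[OF has_sum_add[OF parseval[OF A, of x] has_sum_infsum[OF \<phi>(2)]], of "1/2"]
    by (simp add: nx q_def)
  ultimately have "\<phi> x \<le> (1/2) * (s + q)"
  proof (rule has_sum_mono)
    fix e show "inner x e * \<phi> e \<le> (1/2) * ((inner x e)\<^sup>2 + (\<phi> e)\<^sup>2)"
      using sum_squares_bound[of "inner x e" "\<phi> e"] by simp
  qed
  then show ?thesis unfolding \<phi>x s_def[symmetric] q_def[symmetric] by simp
qed

lemma sum_norm_square_le:
  fixes T :: "'a::real_inner \<Rightarrow> 'a"
  assumes A: "orthonormal_basis A" and F: "finite F" "orthonormal F"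
    and T: "bounded_linear T" "(\<lambda>e. (norm (T e))\<^sup>2) summable_on A"
  shows "(\<Sum>b\<in>F. (norm (T b))\<^sup>2) \<le> (\<Sum>\<^sub>\<infinity>e\<in>A. (norm (T e))\<^sup>2)"
proof -
  have "((\<lambda>a. \<Sum>b\<in>F. (inner (T b) a)\<^sup>2) has_sum (\<Sum>b\<in>F. (norm (T b))\<^sup>2)) A"
    by (intro has_sum_finite_sum F(1) parseval[OF A])
  then show ?thesis
  proof (rule has_sum_le_finite_sums)
    fix G assume G: "finite G" "G \<subseteq> A"
    have oG: "orthonormal G"
      using A G orthonormal_subset orthonormal_basis_def by blast
    have le: "(inner (T e) a)\<^sup>2 \<le> (norm (T e))\<^sup>2" if "a \<in> G" for a e
      using bessel[of "{a}" "T e"] that oG by (auto simp: orthonormal_def)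
    have sm: "(\<lambda>e. (inner (T e) a)\<^sup>2) summable_on A" if "a \<in> G" for a
      by (rule summable_on_comparison_test[OF T(2)]) (auto intro: le[OF that])
    have "(\<Sum>a\<in>G. \<Sum>b\<in>F. (inner (T b) a)\<^sup>2) \<le> (\<Sum>a\<in>G. \<Sum>\<^sub>\<infinity>e\<in>A. (inner (T e) a)\<^sup>2)"
      by (intro sum_mono sum_square_functional_le[OF A F] sm
          bounded_linear_compose[OF bounded_linear_inner_left T(1)])
    also have "\<dots> \<le> (\<Sum>\<^sub>\<infinity>e\<in>A. (norm (T e))\<^sup>2)"
    proof (rule has_sum_mono)
      show "((\<lambda>e. \<Sum>a\<in>G. (inner (T e) a)\<^sup>2) has_sum (\<Sum>a\<in>G. \<Sum>\<^sub>\<infinity>e\<in>A. (inner (T e) a)\<^sup>2)) A"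
        by (intro has_sum_finite_sum G(1) has_sum_infsum sm)
      show "((\<lambda>e. (norm (T e))\<^sup>2) has_sum (\<Sum>\<^sub>\<infinity>e\<in>A. (norm (T e))\<^sup>2)) A"
        by (intro has_sum_infsum T(2))
    qed (rule bessel[OF G(1) oG])
    finally show "(\<Sum>a\<in>G. \<Sum>b\<in>F. (inner (T b) a)\<^sup>2) \<le> (\<Sum>\<^sub>\<infinity>e\<in>A. (norm (T e))\<^sup>2)" .
  qed
qed

lemma hilbert_schmidt_summable:
  assumes "hilbert_schmidt T" "orthonormal_basis B"
  shows "(\<lambda>e. (norm (T e))\<^sup>2) summable_on B"
proof -
  obtain A where A: "orthonormal_basis A" "bounded_linear T" "(\<lambda>e. (norm (T e))\<^sup>2) summable_on A"
    using assms(1) by (auto simp: hilbert_schmidt_def)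
  show ?thesis
  proof (rule nonneg_bdd_above_summable_on)
    show "bdd_above (sum (\<lambda>e. (norm (T e))\<^sup>2) ` {F. F \<subseteq> B \<and> finite F})"
      using sum_norm_square_le[OF A(1) _ _ A(2,3)] orthonormal_subset[of B] assms(2)
      by (intro bdd_aboveI[of _ "\<Sum>\<^sub>\<infinity>e\<in>A. (norm (T e))\<^sup>2"]) (auto simp: orthonormal_basis_def)
  qed auto
qed

lemma hilbert_schmidt_infsum_eq:
  assumes T: "hilbert_schmidt T" and A: "orthonormal_basis A" and B: "orthonormal_basis B"
  shows "(\<Sum>\<^sub>\<infinity>e\<in>A. (norm (T e))\<^sup>2) = (\<Sum>\<^sub>\<infinity>e\<in>B. (norm (T e))\<^sup>2)"
proof -
  have "(\<Sum>\<^sub>\<infinity>e\<in>X. (norm (T e))\<^sup>2) \<le> (\<Sum>\<^sub>\<infinity>e\<in>Y. (norm (T e))\<^sup>2)"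
    if X: "orthonormal_basis X" and Y: "orthonormal_basis Y" for X Y
  proof (rule infsum_le_finite_sums[OF hilbert_schmidt_summable[OF T X]])
    fix F assume "finite F" "F \<subseteq> X"
    then show "(\<Sum>e\<in>F. (norm (T e))\<^sup>2) \<le> (\<Sum>\<^sub>\<infinity>e\<in>Y. (norm (T e))\<^sup>2)"
      using T X orthonormal_subset[of X F]
      by (intro sum_norm_square_le[OF Y] hilbert_schmidt_summable[OF T Y])
         (auto simp: orthonormal_basis_def hilbert_schmidt_def)
  qed
  from this[OF A B] this[OF B A] show ?thesis by simp
qed

text \<open>The Hilbert--Schmidt inner product is computed in this fixed basis; by
  \<open>has_sum_inner_hs\<close> below the value is the same in every orthonormal basis.\<close>

definition some_onb :: "'a::separable_hilbert_space set" where
  "some_onb = (SOME B. orthonormal_basis B \<and> countable B)"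

lemma some_onb: "orthonormal_basis some_onb" "countable some_onb"
  using someI_ex[OF ex_countable_orthonormal_basis] by (auto simp: some_onb_def)

lemma hilbert_schmidt_iff:
  fixes T :: "'a::separable_hilbert_space \<Rightarrow> 'a"
  shows "hilbert_schmidt T \<longleftrightarrow> bounded_linear T \<and> (\<lambda>e. (norm (T e))\<^sup>2) summable_on some_onb"
  using hilbert_schmidt_summable[OF _ some_onb(1)] some_onb(1)
  by (auto simp: hilbert_schmidt_def)

lemma summable_inner:
  fixes S T :: "'b \<Rightarrow> 'a::real_inner"
  assumes "(\<lambda>e. (norm (S e))\<^sup>2) summable_on B" "(\<lambda>e. (norm (T e))\<^sup>2) summable_on B"
  shows "(\<lambda>e. inner (S e) (T e)) summable_on B"
proof -
  have "(\<lambda>e. norm (inner (S e) (T e))) summable_on B"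
  proof (rule summable_on_comparison_test)
    show "(\<lambda>e. (norm (S e))\<^sup>2 + (norm (T e))\<^sup>2) summable_on B"
      using assms by (rule summable_on_add)
    fix e
    have "norm (inner (S e) (T e)) \<le> norm (S e) * norm (T e)"
      by (simp add: Cauchy_Schwarz_ineq2)
    also have "\<dots> \<le> (norm (S e))\<^sup>2 + (norm (T e))\<^sup>2"
      using sum_squares_bound[of "norm (S e)" "norm (T e)"]
        mult_nonneg_nonneg[OF norm_ge_zero[of "S e"] norm_ge_zero[of "T e"]] by linarith
    finally show "norm (inner (S e) (T e)) \<le> (norm (S e))\<^sup>2 + (norm (T e))\<^sup>2" .
  qed auto
  then show ?thesis by (rule abs_summable_summable)
qed

lemma hilbert_schmidt_zero: "hilbert_schmidt (\<lambda>_. 0 :: 'a::separable_hilbert_space)"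
  by (simp add: hilbert_schmidt_iff)

lemma hilbert_schmidt_add:
  fixes S T :: "'a::separable_hilbert_space \<Rightarrow> 'a"
  assumes "hilbert_schmidt S" "hilbert_schmidt T"
  shows "hilbert_schmidt (\<lambda>x. S x + T x)"
proof -
  have ST: "bounded_linear S" "bounded_linear T" "(\<lambda>e. (norm (S e))\<^sup>2) summable_on some_onb"
      "(\<lambda>e. (norm (T e))\<^sup>2) summable_on some_onb"
    using assms by (auto simp: hilbert_schmidt_iff)
  have "(\<lambda>e. (norm (S e))\<^sup>2 + (norm (T e))\<^sup>2 + 2 * inner (S e) (T e)) summable_on some_onb"
    by (intro summable_on_add summable_on_cmult_right summable_inner ST)
  moreover have "(norm (S e + T e))\<^sup>2 = (norm (S e))\<^sup>2 + (norm (T e))\<^sup>2 + 2 * inner (S e) (T e)" for e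
    by (simp add: power2_norm_eq_inner inner_add inner_commute)
  moreover have "bounded_linear (\<lambda>x. S x + T x)"
    by (intro bounded_linear_add ST)
  ultimately show ?thesis by (simp only: hilbert_schmidt_iff simp_thms)
qed

lemma hilbert_schmidt_scaleR:
  fixes T :: "'a::separable_hilbert_space \<Rightarrow> 'a"
  assumes "hilbert_schmidt T"
  shows "hilbert_schmidt (\<lambda>x. c *\<^sub>R T x)"
proof -
  have "(\<lambda>e. c\<^sup>2 * (norm (T e))\<^sup>2) summable_on some_onb"
    using assms unfolding hilbert_schmidt_iff by (auto intro: summable_on_cmult_right)
  moreover have "bounded_linear (\<lambda>x. c *\<^sub>R T x)"
    using assms unfolding hilbert_schmidt_iff by (intro bounded_linear_const_scaleR) auto
  ultimately show ?thesis
    by (simp only: hilbert_schmidt_iff norm_scaleR power_mult_distrib power2_abs simp_thms)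
qed

lemma hilbert_schmidt_uminus:
  fixes T :: "'a::separable_hilbert_space \<Rightarrow> 'a"
  shows "hilbert_schmidt T \<Longrightarrow> hilbert_schmidt (\<lambda>x. - T x)"
  by (drule hilbert_schmidt_scaleR[where c = "-1"]) simp

lemma hilbert_schmidt_minus:
  fixes S T :: "'a::separable_hilbert_space \<Rightarrow> 'a"
  shows "hilbert_schmidt S \<Longrightarrow> hilbert_schmidt T \<Longrightarrow> hilbert_schmidt (\<lambda>x. S x - T x)"
  using hilbert_schmidt_add[OF _ hilbert_schmidt_uminus, of S T] by simp

typedef (overloaded) 'a hs = "{T :: 'a::separable_hilbert_space \<Rightarrow> 'a. hilbert_schmidt T}"
  morphisms hs_apply Hs
  using hilbert_schmidt_zero by blast

setup_lifting type_definition_hs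

lemma hs_eqI: "(\<And>x. hs_apply S x = hs_apply T x) \<Longrightarrow> S = T"
  using hs_apply_inject[of S T] by blast

instantiation hs :: (separable_hilbert_space) real_vector
begin

lift_definition zero_hs :: "'a hs" is "\<lambda>_. 0" by (rule hilbert_schmidt_zero)
lift_definition plus_hs :: "'a hs \<Rightarrow> 'a hs \<Rightarrow> 'a hs" is "\<lambda>S T x. S x + T x"
  by (rule hilbert_schmidt_add)
lift_definition minus_hs :: "'a hs \<Rightarrow> 'a hs \<Rightarrow> 'a hs" is "\<lambda>S T x. S x - T x"
  by (rule hilbert_schmidt_minus)
lift_definition uminus_hs :: "'a hs \<Rightarrow> 'a hs" is "\<lambda>T x. - T x"
  by (rule hilbert_schmidt_uminus)
lift_definition scaleR_hs :: "real \<Rightarrow> 'a hs \<Rightarrow> 'a hs" is "\<lambda>c T x. c *\<^sub>R T x"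
  by (rule hilbert_schmidt_scaleR)

instance
  by intro_classes (transfer; simp add: algebra_simps)+

end

definition hs_inner :: "'a::separable_hilbert_space hs \<Rightarrow> 'a hs \<Rightarrow> real" where
  "hs_inner S T = (\<Sum>\<^sub>\<infinity>e\<in>some_onb. inner (hs_apply S e) (hs_apply T e))"

instantiation hs :: (separable_hilbert_space)
  "{sgn_div_norm, dist_norm, uniformity_dist, open_uniformity}"
begin

definition norm_hs :: "'a hs \<Rightarrow> real" where "norm_hs T = sqrt (hs_inner T T)"
definition dist_hs :: "'a hs \<Rightarrow> 'a hs \<Rightarrow> real" where "dist_hs S T = norm (S - T)"
definition sgn_hs :: "'a hs \<Rightarrow> 'a hs" where "sgn_hs T = T /\<^sub>R norm T"
definition uniformity_hs :: "('a hs \<times> 'a hs) filter" where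
  "uniformity_hs = (INF e\<in>{0<..}. principal {(S, T). dist S T < e})"
definition open_hs :: "'a hs set \<Rightarrow> bool" where
  "open_hs U = (\<forall>S\<in>U. \<forall>\<^sub>F (S', T) in uniformity. S' = S \<longrightarrow> T \<in> U)"

instance
  by intro_classes (rule dist_hs_def sgn_hs_def uniformity_hs_def open_hs_def)+

end

instantiation hs :: (separable_hilbert_space) real_inner
begin

definition inner_hs :: "'a hs \<Rightarrow> 'a hs \<Rightarrow> real" where
  "inner_hs S T = hs_inner S T"

lemma summable_norm_hs: "(\<lambda>e. (norm (hs_apply T e))\<^sup>2) summable_on some_onb"
  for T :: "'a hs"
  using hs_apply[of T] by (auto simp: hilbert_schmidt_iff)

lemma summable_inner_hs: "(\<lambda>e. inner (hs_apply S e) (hs_apply T e)) summable_on some_onb"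
  for S T :: "'a hs"
  by (intro summable_inner summable_norm_hs)

lemma bounded_linear_hs_apply: "bounded_linear (hs_apply T)" for T :: "'a hs"
  using hs_apply[of T] by (auto simp: hilbert_schmidt_def)

lemma hs_eq_0I:
  fixes T :: "'a hs"
  assumes "\<And>e. e \<in> some_onb \<Longrightarrow> hs_apply T e = 0"
  shows "T = 0"
proof (rule hs_eqI)
  fix x
  interpret T: bounded_linear "hs_apply T" by (rule bounded_linear_hs_apply)
  have "((\<lambda>e. hs_apply T (inner x e *\<^sub>R e)) has_sum hs_apply T x) some_onb"
    by (intro has_sum_bounded_linear[OF bounded_linear_hs_apply]
        has_sum_orthonormal_basis[OF some_onb(1)])
  moreover have "((\<lambda>e. hs_apply T (inner x e *\<^sub>R e)) has_sum 0) some_onb"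
    by (intro has_sum_0) (simp add: T.scaleR assms)
  ultimately have "hs_apply T x = 0" by (rule has_sum_unique)
  then show "hs_apply T x = hs_apply 0 x" by (simp add: zero_hs.rep_eq)
qed

instance
proof
  fix S T U :: "'a hs" and a b :: real
  show "inner S T = inner T S" by (simp add: inner_hs_def hs_inner_def inner_commute)
  show "inner (S + T) U = inner S U + inner T U"
    unfolding inner_hs_def hs_inner_def plus_hs.rep_eq inner_add_left
    by (intro infsum_add summable_inner_hs)
  show "inner (a *\<^sub>R S) T = a * inner S T"
    unfolding inner_hs_def hs_inner_def scaleR_hs.rep_eq inner_scaleR_left by (rule infsum_cmult_right')
  show "0 \<le> inner S S" unfolding inner_hs_def hs_inner_def by (intro infsum_nonneg) simp
  show "inner S S = 0 \<longleftrightarrow> S = 0"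
  proof
    assume "inner S S = 0"
    then have "inner (hs_apply S e) (hs_apply S e) = 0" if "e \<in> some_onb" for e
      unfolding inner_hs_def hs_inner_def using nonneg_infsum_le_0D[OF _ summable_inner_hs _ that] by simp
    then show "S = 0" by (intro hs_eq_0I) simp
  qed (simp add: inner_hs_def hs_inner_def zero_hs.rep_eq)
qed (simp add: norm_hs_def inner_hs_def)

end

lemma norm_hs_sq: "(norm T)\<^sup>2 = (\<Sum>\<^sub>\<infinity>e\<in>some_onb. (norm (hs_apply T e))\<^sup>2)"
  for T :: "'a::separable_hilbert_space hs"
  by (simp add: power2_norm_eq_inner inner_hs_def hs_inner_def)

lemma finite_sum_le_norm_hs:
  fixes T :: "'a::separable_hilbert_space hs"
  assumes "finite F" "F \<subseteq> some_onb"
  shows "(\<Sum>e\<in>F. (norm (hs_apply T e))\<^sup>2) \<le> (norm T)\<^sup>2"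
  unfolding norm_hs_sq using assms by (intro finite_sum_le_infsum summable_norm_hs) auto

lemma has_sum_norm_hs:
  fixes T :: "'a::separable_hilbert_space hs"
  assumes "orthonormal_basis B"
  shows "((\<lambda>e. (norm (hs_apply T e))\<^sup>2) has_sum (norm T)\<^sup>2) B"
proof -
  have "hilbert_schmidt (hs_apply T)" using hs_apply[of T] by simp
  from has_sum_infsum[OF hilbert_schmidt_summable[OF this assms]] show ?thesis
    unfolding norm_hs_sq hilbert_schmidt_infsum_eq[OF \<open>hilbert_schmidt (hs_apply T)\<close> some_onb(1) assms] .
qed

lemma has_sum_inner_hs:
  fixes S T :: "'a::separable_hilbert_space hs"
  assumes "orthonormal_basis B"
  shows "((\<lambda>e. inner (hs_apply S e) (hs_apply T e)) has_sum inner S T) B"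
proof -
  have "((\<lambda>e. (norm (hs_apply (S + T) e))\<^sup>2 + - ((norm (hs_apply (S - T) e))\<^sup>2))
      has_sum ((norm (S + T))\<^sup>2 + - ((norm (S - T))\<^sup>2))) B"
    using has_sum_norm_hs[OF assms, of "S - T"]
    by (intro has_sum_add has_sum_norm_hs[OF assms]) (simp add: has_sum_uminus)
  from has_sum_cmult_right[OF this, of "1/4"] show ?thesis
    by (simp add: plus_hs.rep_eq minus_hs.rep_eq power2_norm_eq_inner inner_add inner_diff
        inner_commute algebra_simps)
qed

lemma norm_hs_apply_le: "norm (hs_apply T x) \<le> norm T * norm x"
  for T :: "'a::separable_hilbert_space hs"
proof -
  interpret T: bounded_linear "hs_apply T" by (rule bounded_linear_hs_apply)
  have "((\<lambda>e. hs_apply T (inner x e *\<^sub>R e)) has_sum hs_apply T x) some_onb"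
    by (intro has_sum_bounded_linear[OF bounded_linear_hs_apply]
        has_sum_orthonormal_basis[OF some_onb(1)])
  then have lim: "((\<lambda>F. norm (\<Sum>e\<in>F. hs_apply T (inner x e *\<^sub>R e))) \<longlongrightarrow> norm (hs_apply T x))
      (finite_subsets_at_top some_onb)"
    unfolding has_sum_def by (rule tendsto_norm)
  show ?thesis
  proof (rule tendsto_upperbound[OF lim])
    show "\<forall>\<^sub>F F in finite_subsets_at_top some_onb.
        norm (\<Sum>e\<in>F. hs_apply T (inner x e *\<^sub>R e)) \<le> norm T * norm x"
      unfolding eventually_finite_subsets_at_top
    proof (intro exI[of _ "{}"] conjI allI impI)
      fix F :: "'a set" assume "finite F \<and> {} \<subseteq> F \<and> F \<subseteq> some_onb"
      then have F: "finite F" "F \<subseteq> some_onb" by auto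
      have oF: "orthonormal F"
        using F some_onb(1) orthonormal_subset orthonormal_basis_def by blast
      have "norm (\<Sum>e\<in>F. hs_apply T (inner x e *\<^sub>R e)) \<le> (\<Sum>e\<in>F. \<bar>inner x e\<bar> * \<bar>norm (hs_apply T e)\<bar>)"
        by (intro sum_norm_le) (simp add: T.scaleR)
      also have "\<dots> \<le> L2_set (inner x) F * L2_set (\<lambda>e. norm (hs_apply T e)) F"
        by (rule L2_set_mult_ineq)
      also have "\<dots> \<le> norm x * norm T"
        unfolding L2_set_def using bessel[OF F(1) oF] finite_sum_le_norm_hs[OF F]
        by (intro mult_mono real_le_lsqrt) (auto intro: sum_nonneg)
      finally show "norm (\<Sum>e\<in>F. hs_apply T (inner x e *\<^sub>R e)) \<le> norm T * norm x"
        by (simp add: mult.commute)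
    qed auto
  qed simp
qed


instance hs :: (separable_hilbert_space) banach
proof
  fix X :: "nat \<Rightarrow> 'a hs" assume X: "Cauchy X"
  have "Cauchy (\<lambda>n. hs_apply (X n) x)" for x
  proof (rule metric_CauchyI)
    fix \<epsilon> :: real assume "0 < \<epsilon>"
    then have "0 < \<epsilon> / (norm x + 1)" by (simp add: add_nonneg_pos)
    then obtain N where N: "\<And>m n. m \<ge> N \<Longrightarrow> n \<ge> N \<Longrightarrow> dist (X m) (X n) < \<epsilon> / (norm x + 1)"
      using X unfolding Cauchy_def by blast
    have "dist (hs_apply (X m) x) (hs_apply (X n) x) < \<epsilon>" if mn: "m \<ge> N" "n \<ge> N" for m n
    proof -
      have "dist (hs_apply (X m) x) (hs_apply (X n) x) \<le> norm (X m - X n) * norm x"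
        using norm_hs_apply_le[of "X m - X n" x] by (simp add: dist_norm minus_hs.rep_eq)
      also have "\<dots> \<le> norm (X m - X n) * (norm x + 1)" by (intro mult_left_mono) auto
      also have "\<dots> < \<epsilon>"
        using N[OF mn] by (simp add: dist_norm pos_less_divide_eq add_nonneg_pos)
      finally show ?thesis .
    qed
    then show "\<exists>N. \<forall>m\<ge>N. \<forall>n\<ge>N. dist (hs_apply (X m) x) (hs_apply (X n) x) < \<epsilon>" by blast
  qed
  then have "\<exists>y. (\<lambda>n. hs_apply (X n) x) \<longlonglongrightarrow> y" for x
    using Cauchy_convergent convergent_def by blast
  then obtain T where T: "\<And>x. (\<lambda>n. hs_apply (X n) x) \<longlonglongrightarrow> T x" by metis
  interpret X: bounded_linear "hs_apply (X n)" for n by (rule bounded_linear_hs_apply)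
  obtain K where K: "\<And>n. norm (X n) \<le> K"
    using Cauchy_Bseq[OF X] by (auto simp: Bseq_def)
  have bl: "bounded_linear T"
  proof (rule bounded_linear_intro)
    fix x y :: 'a and c :: real
    have "(\<lambda>n. hs_apply (X n) (x + y)) \<longlonglongrightarrow> T x + T y"
      unfolding X.add by (intro tendsto_add T)
    then show "T (x + y) = T x + T y" using T LIMSEQ_unique by blast
    have "(\<lambda>n. hs_apply (X n) (c *\<^sub>R x)) \<longlonglongrightarrow> c *\<^sub>R T x"
      unfolding X.scaleR by (intro tendsto_scaleR tendsto_const T)
    then show "T (c *\<^sub>R x) = c *\<^sub>R T x" using T LIMSEQ_unique by blast
    have "norm (hs_apply (X n) x) \<le> norm x * K" for n
      using norm_hs_apply_le[of "X n" x] mult_right_mono[OF K[of n] norm_ge_zero[of x]]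
      by (simp add: mult.commute)
    then show "norm (T x) \<le> norm x * K"
      by (intro tendsto_upperbound[OF tendsto_norm[OF T]]) auto
  qed
  have fin: "\<exists>N. \<forall>n\<ge>N. \<forall>F. finite F \<longrightarrow> F \<subseteq> some_onb \<longrightarrow>
      (\<Sum>e\<in>F. (norm (hs_apply (X n) e - T e))\<^sup>2) \<le> \<epsilon>\<^sup>2" if \<epsilon>: "0 < \<epsilon>" for \<epsilon>
  proof -
    obtain N where N: "\<And>m n. m \<ge> N \<Longrightarrow> n \<ge> N \<Longrightarrow> norm (X m - X n) < \<epsilon>"
      using X \<epsilon> unfolding Cauchy_def dist_norm by blast
    have "(\<Sum>e\<in>F. (norm (hs_apply (X n) e - T e))\<^sup>2) \<le> \<epsilon>\<^sup>2"
      if n: "n \<ge> N" and F: "finite F" "F \<subseteq> some_onb" for n F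
    proof (rule tendsto_upperbound)
      show "(\<lambda>m. \<Sum>e\<in>F. (norm (hs_apply (X n) e - hs_apply (X m) e))\<^sup>2)
          \<longlonglongrightarrow> (\<Sum>e\<in>F. (norm (hs_apply (X n) e - T e))\<^sup>2)"
        by (intro tendsto_intros T)
      show "\<forall>\<^sub>F m in sequentially. (\<Sum>e\<in>F. (norm (hs_apply (X n) e - hs_apply (X m) e))\<^sup>2) \<le> \<epsilon>\<^sup>2"
        unfolding eventually_sequentially
      proof (intro exI[of _ N] allI impI)
        fix m assume m: "N \<le> m"
        have "(\<Sum>e\<in>F. (norm (hs_apply (X n) e - hs_apply (X m) e))\<^sup>2) \<le> (norm (X n - X m))\<^sup>2"
          using finite_sum_le_norm_hs[OF F, of "X n - X m"] by (simp add: minus_hs.rep_eq)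
        also have "\<dots> \<le> \<epsilon>\<^sup>2" using N[OF n m] by (intro power_mono) auto
        finally show "(\<Sum>e\<in>F. (norm (hs_apply (X n) e - hs_apply (X m) e))\<^sup>2) \<le> \<epsilon>\<^sup>2" .
      qed
    qed simp
    then show ?thesis by blast
  qed
  have hsT: "hilbert_schmidt T"
  proof -
    obtain N where "\<forall>n\<ge>N. \<forall>F. finite F \<longrightarrow> F \<subseteq> some_onb \<longrightarrow>
      (\<Sum>e\<in>F. (norm (hs_apply (X n) e - T e))\<^sup>2) \<le> 1\<^sup>2" using fin[of 1] by auto
    then have N: "(\<Sum>e\<in>F. (norm (hs_apply (X N) e - T e))\<^sup>2) \<le> 1"
      if "finite F" "F \<subseteq> some_onb" for F using that by simp
    have "(\<lambda>e. (norm (hs_apply (X N) e - T e))\<^sup>2) summable_on some_onb"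
      using N by (intro nonneg_bdd_above_summable_on) (auto intro!: bdd_aboveI[of _ 1])
    moreover have "bounded_linear (\<lambda>x. hs_apply (X N) x - T x)"
      by (intro bounded_linear_sub bounded_linear_hs_apply bl)
    ultimately have h: "hilbert_schmidt (\<lambda>x. hs_apply (X N) x - T x)"
      unfolding hilbert_schmidt_iff by blast
    have "hilbert_schmidt (hs_apply (X N))" using hs_apply[of "X N"] by simp
    from hilbert_schmidt_minus[OF this h]
    show ?thesis by simp
  qed
  then have HT: "hs_apply (Hs T) = T" by (simp add: Hs_inverse)
  have "X \<longlonglongrightarrow> Hs T"
  proof (rule LIMSEQ_I)
    fix \<epsilon> :: real assume "0 < \<epsilon>"
    then have \<epsilon>: "0 < \<epsilon> / 2" by simp
    obtain N where N: "\<forall>n\<ge>N. \<forall>F. finite F \<longrightarrow> F \<subseteq> some_onb \<longrightarrow>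
      (\<Sum>e\<in>F. (norm (hs_apply (X n) e - T e))\<^sup>2) \<le> (\<epsilon> / 2)\<^sup>2" using fin[OF \<epsilon>] by blast
    have "norm (X n - Hs T) < \<epsilon>" if "n \<ge> N" for n
    proof -
      have "(norm (X n - Hs T))\<^sup>2 \<le> (\<epsilon> / 2)\<^sup>2"
        using N that
        by (intro has_sum_le_finite_sums[OF has_sum_norm_hs[OF some_onb(1)]])
           (simp add: minus_hs.rep_eq HT)
      then have "norm (X n - Hs T) \<le> \<epsilon> / 2"
        by (rule power2_le_imp_le) (use \<epsilon> in simp)
      then show ?thesis using \<epsilon> by linarith
    qed
    then show "\<exists>N. \<forall>n\<ge>N. norm (X n - Hs T) < \<epsilon>" by blast
  qed
  then show "convergent X" by (rule convergentI)
qed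

definition finite_rank :: "('a \<times> 'a) list \<Rightarrow> 'a::separable_hilbert_space \<Rightarrow> 'a" where
  "finite_rank ps x = (\<Sum>(e, d)\<leftarrow>ps. inner x e *\<^sub>R d)"

lemma hilbert_schmidt_finite_rank: "hilbert_schmidt (finite_rank ps)"
proof (induction ps)
  case Nil
  then show ?case using hilbert_schmidt_zero by (simp add: finite_rank_def[abs_def])
next
  case (Cons p ps)
  obtain e d where p: "p = (e, d)" by fastforce
  have "(\<lambda>x. (norm d)\<^sup>2 * (inner e x)\<^sup>2) summable_on some_onb"
    using parseval[OF some_onb(1), of e]
    by (intro summable_on_cmult_right) (auto simp: summable_on_def)
  moreover have "(norm (inner x e *\<^sub>R d))\<^sup>2 = (norm d)\<^sup>2 * (inner e x)\<^sup>2" for x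
    by (simp add: power_mult_distrib inner_commute)
  moreover have "bounded_linear (\<lambda>x. inner x e *\<^sub>R d)"
    by (intro bounded_linear_scaleR_const bounded_linear_inner_left)
  ultimately have "hilbert_schmidt (\<lambda>x. inner x e *\<^sub>R d)" by (simp only: hilbert_schmidt_iff simp_thms)
  from hilbert_schmidt_add[OF this Cons.IH] show ?case
    by (simp add: finite_rank_def[abs_def] p)
qed

lemma ex_countable_dense_hs:
  "\<exists>D::'a::separable_hilbert_space hs set. countable D \<and> (\<forall>T. \<forall>\<epsilon>>0. \<exists>S\<in>D. norm (T - S) < \<epsilon>)"
proof -
  obtain D0 :: "'a set" where D0: "countable D0" "\<And>X. open X \<Longrightarrow> X \<noteq> {} \<Longrightarrow> \<exists>d\<in>D0. d \<in> X"
    by (rule countable_dense_setE) auto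
  define D where "D = (\<lambda>ps. Hs (finite_rank ps)) ` lists ((some_onb :: 'a set) \<times> D0)"
  have "countable D"
    unfolding D_def by (intro countable_image countable_lists countable_SIGMA some_onb D0)
  moreover have "\<exists>S\<in>D. norm (T - S) < \<epsilon>" if "0 < \<epsilon>" for T :: "'a hs" and \<epsilon> :: real
  proof -
    define \<delta> where "\<delta> = \<epsilon>\<^sup>2 / 4"
    have \<delta>: "0 < \<delta>" using that by (simp add: \<delta>_def)
    have "\<forall>\<^sub>F F in finite_subsets_at_top some_onb.
        dist (\<Sum>e\<in>F. (norm (hs_apply T e))\<^sup>2) ((norm T)\<^sup>2) < \<delta>"
      using has_sum_norm_hs[OF some_onb(1), of T] \<delta> unfolding has_sum_def by (rule tendstoD)
    then obtain F where F: "finite F" "F \<subseteq> some_onb"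
        "dist (\<Sum>e\<in>F. (norm (hs_apply T e))\<^sup>2) ((norm T)\<^sup>2) < \<delta>"
      unfolding eventually_finite_subsets_at_top by blast
    define \<eta> where "\<eta> = sqrt (\<delta> / (real (card F) + 1))"
    have \<eta>: "0 < \<eta>" "\<eta>\<^sup>2 = \<delta> / (real (card F) + 1)" using \<delta> by (auto simp: \<eta>_def)
    have "\<exists>d\<in>D0. d \<in> ball (hs_apply T e) \<eta>" for e using \<eta> by (intro D0(2)) auto
    then obtain d where d: "\<And>e. d e \<in> D0" "\<And>e. norm (hs_apply T e - d e) < \<eta>"
      unfolding mem_ball dist_norm by metis
    obtain es where es: "set es = F" "distinct es" using finite_distinct_list[OF F(1)] by blast
    define ps where "ps = map (\<lambda>e. (e, d e)) es"
    have fr: "finite_rank ps x = (\<Sum>e\<in>F. inner x e *\<^sub>R d e)" for x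
      using es by (simp add: finite_rank_def ps_def comp_def sum_list_distinct_conv_sum_set)
    have onb: "orthonormal (some_onb :: 'a set)"
      by (rule conjunct1[OF some_onb(1)[unfolded orthonormal_basis_def]])
    have fr1: "finite_rank ps x = (if x \<in> F then d x else 0)" if "x \<in> some_onb" for x
    proof -
      have "finite_rank ps x = (\<Sum>e\<in>F. if x = e then d e else 0)"
        unfolding fr using F(2) that orthonormal_inner[OF onb that] by (intro sum.cong) auto
      then show ?thesis using F(1) by simp
    qed
    define S where "S = Hs (finite_rank ps)"
    have S: "hs_apply S = finite_rank ps"
      by (simp add: S_def Hs_inverse hilbert_schmidt_finite_rank)
    have "ps \<in> lists (some_onb \<times> D0)" using es F(2) d(1) by (auto simp: ps_def in_lists_conv_set)
    then have "S \<in> D" unfolding S_def D_def by (rule imageI)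
    define g where "g e = (norm (hs_apply (T - S) e))\<^sup>2" for e
    have "(norm (T - S))\<^sup>2 \<le> \<delta> + \<delta>"
    proof (rule has_sum_le_finite_sums[OF has_sum_norm_hs[OF some_onb(1)]])
      fix G :: "'a set" assume G: "finite G" "G \<subseteq> some_onb"
      have "(\<Sum>e\<in>G. (norm (hs_apply (T - S) e))\<^sup>2) \<le> (\<Sum>e\<in>F \<union> (G - F). g e)"
        unfolding g_def using F G by (intro sum_mono2) auto
      also have "\<dots> = (\<Sum>e\<in>F. g e) + (\<Sum>e\<in>G - F. g e)"
        using F G by (intro sum.union_disjoint) auto
      also have "(\<Sum>e\<in>F. g e) \<le> (\<Sum>e\<in>F. \<eta>\<^sup>2)"
      proof (rule sum_mono)
        fix e assume e: "e \<in> F"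
        then have "e \<in> some_onb" using F(2) by auto
        then show "g e \<le> \<eta>\<^sup>2"
          using e d(2)[of e] by (auto simp: g_def minus_hs.rep_eq S fr1 intro!: power_mono)
      qed
      also have "(\<Sum>e\<in>F. \<eta>\<^sup>2) \<le> \<delta>"
        using \<delta> by (simp add: \<eta>(2) field_simps)
      also have "(\<Sum>e\<in>G - F. g e) = (\<Sum>e\<in>G - F. (norm (hs_apply T e))\<^sup>2)"
        using G by (intro sum.cong) (auto simp: g_def minus_hs.rep_eq S fr1)
      also have "(\<Sum>e\<in>G - F. (norm (hs_apply T e))\<^sup>2) \<le> \<delta>"
      proof -
        have "(\<Sum>e\<in>F. (norm (hs_apply T e))\<^sup>2) + (\<Sum>e\<in>G - F. (norm (hs_apply T e))\<^sup>2)
            = (\<Sum>e\<in>F \<union> (G - F). (norm (hs_apply T e))\<^sup>2)"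
          using F G by (intro sum.union_disjoint[symmetric]) auto
        also have "\<dots> \<le> (norm T)\<^sup>2" using F G by (intro finite_sum_le_norm_hs) auto
        finally show ?thesis using F(3) by (simp add: dist_real_def)
      qed
      finally show "(\<Sum>e\<in>G. (norm (hs_apply (T - S) e))\<^sup>2) \<le> \<delta> + \<delta>" by simp
    qed
    also have "\<delta> + \<delta> < \<epsilon>\<^sup>2" using that by (simp add: \<delta>_def)
    finally have "norm (T - S) < \<epsilon>" by (rule power2_less_imp_less) (use that in simp)
    with \<open>S \<in> D\<close> show ?thesis by blast
  qed
  ultimately show ?thesis by blast
qed

instance hs :: (separable_hilbert_space) polish_space
proof
  obtain D :: "'a hs set" where D: "countable D"
    "\<And>T \<epsilon>. 0 < \<epsilon> \<Longrightarrow> \<exists>S\<in>D. norm (T - S) < \<epsilon>"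
    using ex_countable_dense_hs by blast
  define B where "B = (\<lambda>(S, n). ball S (1 / real (Suc n))) ` (D \<times> (UNIV :: nat set))"
  have "countable B" unfolding B_def by (intro countable_image countable_SIGMA D) auto
  moreover have "topological_basis B"
  proof (rule topological_basisI)
    fix U assume "U \<in> B" then show "open U" by (auto simp: B_def)
  next
    fix U and T :: "'a hs" assume "open U" "T \<in> U"
    then obtain r where r: "0 < r" "ball T r \<subseteq> U" by (meson openE)
    obtain n where n: "1 / real (Suc n) < r / 2"
      using reals_Archimedean[of "r / 2"] r(1) by (auto simp: inverse_eq_divide)
    obtain S where S: "S \<in> D" "norm (T - S) < 1 / real (Suc n)" using D(2)[of "1 / real (Suc n)" T] by auto
    have "ball S (1 / real (Suc n)) \<subseteq> ball T r"
    proof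
      fix V assume "V \<in> ball S (1 / real (Suc n))"
      then have "dist S V < 1 / real (Suc n)" by simp
      moreover have "dist T V \<le> dist T S + dist S V" by (rule dist_triangle)
      ultimately show "V \<in> ball T r" using S(2) n by (simp add: dist_norm)
    qed
    moreover have "T \<in> ball S (1 / real (Suc n))" using S(2) by (simp add: dist_norm norm_minus_commute)
    moreover have "ball S (1 / real (Suc n)) \<in> B" unfolding B_def using S(1) by auto
    ultimately show "\<exists>B'\<in>B. T \<in> B' \<and> B' \<subseteq> U" using r(2) by blast
  qed
  ultimately have "countable B \<and> open = generate_topology B"
    using topological_basis_imp_subbasis[of B] by simp
  then show "\<exists>B::'a hs set set. countable B \<and> open = generate_topology B" by (rule exI)
qed

instance hs :: (separable_hilbert_space) separable_hilbert_space ..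

definition self_adjoint :: "('a::real_inner \<Rightarrow> 'a) \<Rightarrow> bool" where
  "self_adjoint A \<longleftrightarrow> (\<forall>x y. inner (A x) y = inner x (A y))"

definition nonneg_definite :: "('a::real_inner \<Rightarrow> 'a) \<Rightarrow> bool" where
  "nonneg_definite A \<longleftrightarrow> (\<forall>x. 0 \<le> inner (A x) x)"

text \<open>Trace class operators on a Hilbert space, in their description as nuclear operators.\<close>

definition trace_class :: "('a::real_inner \<Rightarrow> 'a) \<Rightarrow> bool" where
  "trace_class A \<longleftrightarrow> (\<exists>a b :: nat \<Rightarrow> 'a. summable (\<lambda>n. norm (a n) * norm (b n)) \<and>
     (\<forall>x. (\<lambda>n. inner x (a n) *\<^sub>R b n) sums A x))"

text \<open>Paths need not be cadlag; stochastic continuity is enough. Only the values at times \<open>t \<ge> 0\<close> matter.\<close>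

locale levy_process = prob_space M
  for M :: "'w measure" and X :: "real \<Rightarrow> 'w \<Rightarrow> 'b::{real_normed_vector, second_countable_topology}" +
  assumes measurable_X: "0 \<le> t \<Longrightarrow> X t \<in> borel_measurable M"
    and starts_at_0: "AE \<omega> in M. X 0 \<omega> = 0"
    and independent_increments:
      "incseq \<tau> \<Longrightarrow> 0 \<le> \<tau> 0 \<Longrightarrow>
        indep_vars (\<lambda>_. borel) (\<lambda>i \<omega>. X (\<tau> (Suc i)) \<omega> - X (\<tau> i) \<omega>) {..<n::nat}"
    and stationary_increments:
      "0 \<le> s \<Longrightarrow> 0 \<le> h \<Longrightarrow>
        distr M borel (\<lambda>\<omega>. X (s + h) \<omega> - X s \<omega>) = distr M borel (X h)"
    and stochastically_continuous:
      "0 \<le> t \<Longrightarrow> 0 < \<epsilon> \<Longrightarrow>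
        ((\<lambda>s. prob {\<omega> \<in> space M. \<epsilon> < norm (X s \<omega> - X t \<omega>)}) \<longlongrightarrow> 0) (at t within {0..})"

definition square_integrable_process ::
    "'w measure \<Rightarrow> (real \<Rightarrow> 'w \<Rightarrow> 'b::real_normed_vector) \<Rightarrow> bool" where
  "square_integrable_process M X \<longleftrightarrow> (\<forall>t\<ge>0. integrable M (\<lambda>\<omega>. (norm (X t \<omega>))\<^sup>2))"

definition nondecreasing_paths ::
    "'w measure \<Rightarrow> (real \<Rightarrow> 'w \<Rightarrow> 'h::separable_hilbert_space hs) \<Rightarrow> bool" where
  "nondecreasing_paths M L \<longleftrightarrow> (AE \<omega> in M.
     (\<forall>t\<ge>0. self_adjoint (hs_apply (L t \<omega>))) \<and>
     (\<forall>f. mono_on {0..} (\<lambda>t. inner (hs_apply (L t \<omega>) f) f)))"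

definition levy_measure :: "'b::real_normed_vector measure \<Rightarrow> bool" where
  "levy_measure \<nu> \<longleftrightarrow> sets \<nu> = sets borel \<and> emeasure \<nu> {0} = 0 \<and>
     (\<integral>\<^sup>+ z. ennreal (min 1 ((norm z)\<^sup>2)) \<partial>\<nu>) < \<infinity>"

definition levy_exponent ::
    "'b::real_inner \<Rightarrow> ('b \<Rightarrow> 'b) \<Rightarrow> 'b measure \<Rightarrow> 'b \<Rightarrow> complex" where
  "levy_exponent D Q \<nu> T =
     \<i> * complex_of_real (inner D T) - complex_of_real (inner (Q T) T) / 2
     + (CLINT z|\<nu>. iexp (inner z T) - 1
          - \<i> * complex_of_real (indicator {z. norm z \<le> 1} z * inner z T))"

definition levy_khintchine_triplet ::
    "'w measure \<Rightarrow> (real \<Rightarrow> 'w \<Rightarrow> 'b::real_inner) \<Rightarrow> 'b \<Rightarrow> ('b \<Rightarrow> 'b) \<Rightarrow> 'b measure \<Rightarrow> bool" where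
  "levy_khintchine_triplet M X D Q \<nu> \<longleftrightarrow>
     bounded_linear Q \<and> self_adjoint Q \<and> nonneg_definite Q \<and> trace_class Q \<and> levy_measure \<nu> \<and>
     (\<forall>t\<ge>0. \<forall>T. (CLINT \<omega>|M. iexp (inner (X t \<omega>) T))
        = exp (complex_of_real t * levy_exponent D Q \<nu> T))"

end

theory Submission
  imports Defs
begin

text \<open>
  For a rank-one operator \<open>f \<otimes> f\<close> the real process \<open>\<langle>L t, f \<otimes> f\<rangle> = (L t f, f)\<close> is nonnegative.
  Dividing it by \<open>sqrt t\<close> and letting \<open>t\<close> tend to \<open>0\<close> kills the drift and the jumps in the
  characteristic function, so the limit law is the centred Gaussian with variance
  \<open>\<langle>Q0 (f \<otimes> f), f \<otimes> f\<rangle>\<close>. A nondegenerate Gaussian charges the negative half-line, hence this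
  variance, and with it \<open>Q0 (f \<otimes> f)\<close>, is zero. By self-adjointness of \<open>Q0\<close> the quadratic form of
  \<open>Q0 T\<close> then vanishes, i.e. \<open>Q0 T\<close> is antisymmetric and therefore orthogonal to the symmetric \<open>T\<close>;
  since \<open>Q0\<close> is nonnegative definite, \<open>\<langle>Q0 T, T\<rangle> = 0\<close> forces \<open>Q0 T = 0\<close>.
\<close>

section \<open>Zeros of nonnegative definite quadratic forms\<close>

text \<open>Perturbing \<open>x\<close> in the direction \<open>A x\<close> makes the form
  \<open>2 * c * n + c\<^sup>2 * b\<close>, with \<open>n\<close> the squared norm of
  \<open>A x\<close>. For small negative \<open>c\<close> the linear term wins, so
  \<open>n > 0\<close> would make the form negative.\<close>

lemma nonneg_definite_inner_eq_0D:
  fixes A :: "'a::real_inner \<Rightarrow> 'a"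
  assumes "linear A" "self_adjoint A" "nonneg_definite A" "inner (A x) x = 0"
  shows "A x = 0"
proof (rule ccontr)
  assume "A x \<noteq> 0"
  define n where "n = inner (A x) (A x)"
  define b where "b = inner (A (A x)) (A x)"
  \<comment> \<open>\<open>- n / b\<close> would minimise the quadratic form along \<open>x + c *\<^sub>R A x\<close>, but \<open>b\<close> may be \<open>0\<close>.\<close>
  define c where "c = - n / (b + 1)"
  have n: "0 < n" using \<open>A x \<noteq> 0\<close> by (simp add: n_def)
  have b: "0 \<le> b" using assms(3) by (auto simp: b_def nonneg_definite_def)
  have "inner (A (A x)) x = n"
    using assms(2) by (simp add: n_def self_adjoint_def)
  then have "inner (A (x + c *\<^sub>R A x)) (x + c *\<^sub>R A x) = 2 * c * n + c\<^sup>2 * b"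
    using assms(4)
    by (simp add: linear_add[OF assms(1)] linear_scale[OF assms(1)] inner_add n_def b_def
        power2_eq_square algebra_simps)
  moreover have "0 \<le> inner (A (x + c *\<^sub>R A x)) (x + c *\<^sub>R A x)"
    using assms(3) by (auto simp: nonneg_definite_def)
  moreover have "2 * c * n + c\<^sup>2 * b = - (n\<^sup>2 / (b + 1)) * (1 + 1 / (b + 1))"
    using b unfolding c_def by (simp add: divide_simps power2_eq_square) algebra
  moreover have "0 < n\<^sup>2 / (b + 1) * (1 + 1 / (b + 1))"
    using n b by (intro mult_pos_pos[OF divide_pos_pos]) (simp_all add: add_pos_nonneg)
  ultimately show False by linarith
qed

section \<open>Rank-one operators and the Hilbert-Schmidt pairing\<close>

definition rank_one :: "'a::separable_hilbert_space \<Rightarrow> 'a hs" where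
  "rank_one f = Hs (finite_rank [(f, f)])"

lemma hs_apply_rank_one: "hs_apply (rank_one f) x = inner x f *\<^sub>R f"
  unfolding rank_one_def using hilbert_schmidt_finite_rank[of "[(f, f)]"]
  by (simp add: Hs_inverse finite_rank_def)

text \<open>Expand the first argument \<open>f\<close> of the quadratic form in the basis. This
  identity turns monotone paths of quadratic forms into real projections of the process in the
  Hilbert-Schmidt space.\<close>

lemma inner_rank_one: "inner S (rank_one f) = inner (hs_apply S f) f"
  for S :: "'a::separable_hilbert_space hs"
proof -
  interpret S: bounded_linear "hs_apply S" by (rule bounded_linear_hs_apply)
  have "((\<lambda>e. inner (hs_apply S (inner f e *\<^sub>R e)) f) has_sum inner (hs_apply S f) f) some_onb"
    by (intro has_sum_bounded_linear[OF bounded_linear_compose[OF bounded_linear_inner_left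
          bounded_linear_hs_apply]] has_sum_orthonormal_basis[OF some_onb(1)])
  moreover have "((\<lambda>e. inner (hs_apply S (inner f e *\<^sub>R e)) f) has_sum inner S (rank_one f)) some_onb"
    using has_sum_inner_hs[OF some_onb(1), of S "rank_one f"]
    by (simp add: hs_apply_rank_one S.scaleR inner_commute mult.commute)
  ultimately show ?thesis by (rule has_sum_unique[symmetric])
qed

text \<open>The pairing is a double sum of products of matrix entries. One factor is antisymmetric
  and the other symmetric, so exchanging the indices shows that the sum equals its own
  negative.\<close>

lemma inner_hs_antisymmetric_self_adjoint:
  fixes R T :: "'a::separable_hilbert_space hs"
  assumes R: "\<And>f. inner (hs_apply R f) f = 0" and T: "self_adjoint (hs_apply T)"
  shows "inner R T = 0"
proof -
  interpret R: bounded_linear "hs_apply R" by (rule bounded_linear_hs_apply)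
  define B where "B = (some_onb :: 'a set)"
  have B: "orthonormal_basis B" unfolding B_def by (rule some_onb)
  define a where "a e g = inner (hs_apply R e) g * inner (hs_apply T e) g" for e g
  \<comment> \<open>Polarisation: expand the vanishing form at \<open>e + g\<close>.\<close>
  have anti: "inner (hs_apply R e) g = - inner (hs_apply R g) e" for e g
    using R[of "e + g"] R[of e] R[of g] by (simp add: R.add inner_add)
  have swap: "a e g = - a g e" for e g
  proof -
    have "inner (hs_apply T e) g = inner (hs_apply T g) e"
      using T by (simp add: self_adjoint_def inner_commute)
    then show ?thesis by (simp add: a_def anti[of e g])
  qed
  \<comment> \<open>Exchanging the two infinite sums requires summability over pairs. By Parseval
    the squared matrix entries sum to the squared Hilbert-Schmidt norm, and they dominate the
    products \<open>a e g\<close>.\<close>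
  have sq: "(\<lambda>(e, g). (inner (hs_apply S e) g)\<^sup>2) summable_on B \<times> B" for S :: "'a hs"
    using has_sum_norm_hs[OF B, of S]
    by (intro summable_on_SigmaI[where g = "\<lambda>e. (norm (hs_apply S e))\<^sup>2"])
       (auto intro: parseval[OF B] has_sum_imp_summable)
  have abs: "norm (a e g) \<le> (inner (hs_apply R e) g)\<^sup>2 + (inner (hs_apply T e) g)\<^sup>2" for e g
  proof -
    have "2 * norm (a e g) \<le> (inner (hs_apply R e) g)\<^sup>2 + (inner (hs_apply T e) g)\<^sup>2"
      using sum_squares_bound[of "\<bar>inner (hs_apply R e) g\<bar>" "\<bar>inner (hs_apply T e) g\<bar>"]
      by (simp add: a_def abs_mult)
    then show ?thesis using norm_ge_zero[of "a e g"] by linarith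
  qed
  have "(\<lambda>p. norm (case p of (e, g) \<Rightarrow> a e g)) summable_on B \<times> B"
    by (rule summable_on_comparison_test[OF summable_on_add[OF sq[of R] sq[of T]]])
       (simp_all add: abs[unfolded real_norm_def] split_beta)
  then have sm: "(\<lambda>(e, g). a e g) summable_on B \<times> B" by (rule abs_summable_summable)
  have row: "(\<Sum>\<^sub>\<infinity>g\<in>B. a e g) = inner (hs_apply R e) (hs_apply T e)" for e
  proof (rule infsumI)
    have "((\<lambda>g. inner (hs_apply R e) (inner (hs_apply T e) g *\<^sub>R g))
        has_sum inner (hs_apply R e) (hs_apply T e)) B"
      by (intro has_sum_bounded_linear[OF bounded_linear_inner_right]
          has_sum_orthonormal_basis[OF B])
    then show "((\<lambda>g. a e g) has_sum inner (hs_apply R e) (hs_apply T e)) B"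
      by (simp add: a_def mult.commute)
  qed
  have "inner R T = (\<Sum>\<^sub>\<infinity>e\<in>B. \<Sum>\<^sub>\<infinity>g\<in>B. a e g)"
    unfolding row using has_sum_inner_hs[OF B, of R T] by (simp add: infsumI)
  also have "\<dots> = (\<Sum>\<^sub>\<infinity>g\<in>B. \<Sum>\<^sub>\<infinity>e\<in>B. a e g)" by (rule infsum_swap_banach[OF sm])
  also have "\<dots> = - (\<Sum>\<^sub>\<infinity>g\<in>B. \<Sum>\<^sub>\<infinity>e\<in>B. a g e)"
    by (subst swap) (simp add: infsum_uminus)
  also have "\<dots> = - inner R T"
    unfolding row using has_sum_inner_hs[OF B, of R T] by (simp add: infsumI)
  finally show ?thesis by simp
qed

section \<open>The Levy exponent at large arguments\<close>

text \<open>Inside the unit ball the integrand is a second-order Taylor remainder; outside it is at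
  most 2. The constant covers both cases, and the right-hand side is integrable for a Levy
  measure.\<close>

lemma norm_levy_integrand_le:
  fixes z T :: "'b::real_inner"
  shows "norm (iexp (inner z T) - 1 - \<i> * complex_of_real (indicator {z. norm z \<le> 1} z * inner z T))
    \<le> (2 + (norm T)\<^sup>2) * min 1 ((norm z)\<^sup>2)"
proof (cases "norm z \<le> 1")
  case True
  define x where "x = inner z T"
  have "norm (iexp x - 1 - \<i> * complex_of_real x) \<le> x\<^sup>2 / 2"
    using iexp_approx1[of x 1] by (simp add: algebra_simps power2_eq_square)
  also have "\<dots> \<le> x\<^sup>2" by simp
  also have "\<dots> \<le> (norm z * norm T)\<^sup>2"
    using Cauchy_Schwarz_ineq2[of z T] unfolding x_def abs_le_square_iff[symmetric] by simp
  also have "\<dots> \<le> (2 + (norm T)\<^sup>2) * (norm z)\<^sup>2"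
    by (simp add: power_mult_distrib algebra_simps)
  finally show ?thesis using True by (simp add: x_def power_le_one)
next
  case False
  have "norm (iexp (inner z T) - 1) \<le> norm (iexp (inner z T)) + norm (1::complex)"
    by (rule norm_triangle_ineq4)
  also have "\<dots> \<le> 2 + (norm T)\<^sup>2" by simp
  finally show ?thesis using False by (simp add: min_absorb1 one_le_power)
qed

text \<open>After division by \<open>s\<^sup>2\<close> the drift is of order \<open>1 / s\<close>,
  the Gaussian term does not depend on \<open>s\<close>, and the jump integral vanishes by dominated
  convergence.\<close>

lemma tendsto_levy_exponent_scaled:
  fixes D T :: "'b::{real_inner, second_countable_topology}"
  assumes Q: "linear Q" and \<nu>: "levy_measure \<nu>"
  shows "((\<lambda>s. levy_exponent D Q \<nu> (s *\<^sub>R T) / complex_of_real (s\<^sup>2))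
    \<longlongrightarrow> - complex_of_real (inner (Q T) T) / 2) at_top"
proof -
  have sets[measurable_cong]: "sets \<nu> = sets borel" using \<nu> by (simp add: levy_measure_def)
  define J where "J s z = iexp (inner z (s *\<^sub>R T)) - 1
    - \<i> * complex_of_real (indicator {z. norm z \<le> 1} z * inner z (s *\<^sub>R T))" for s and z :: 'b
  have lim: "((\<lambda>s. CLINT z|\<nu>. J s z / complex_of_real (s\<^sup>2)) \<longlongrightarrow> (CLINT z|\<nu>. 0)) at_top"
  proof (rule integral_dominated_convergence_at_top)
    have "integrable \<nu> (\<lambda>z. min 1 ((norm z)\<^sup>2))"
      using \<nu> by (intro integrableI_bounded) (auto simp: levy_measure_def)
    then show "integrable \<nu> (\<lambda>z. (2 + (norm T)\<^sup>2) * min 1 ((norm z)\<^sup>2))" by simp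
    show "(\<lambda>z. J s z / complex_of_real (s\<^sup>2)) \<in> borel_measurable \<nu>" for s
      unfolding J_def by measurable
    \<comment> \<open>For \<open>s \<ge> 1\<close> the factor
      \<open>2 + s\<^sup>2 * (norm T)\<^sup>2\<close> is at most
      \<open>s\<^sup>2 * (2 + (norm T)\<^sup>2)\<close>, so the majorant is free of
      \<open>s\<close>.\<close>
    show "\<forall>\<^sub>F s in at_top. AE z in \<nu>. norm (J s z / complex_of_real (s\<^sup>2))
        \<le> (2 + (norm T)\<^sup>2) * min 1 ((norm z)\<^sup>2)"
      using eventually_ge_at_top[of 1]
    proof eventually_elim
      case (elim s)
      have "norm (J s z / complex_of_real (s\<^sup>2)) \<le> (2 + (norm T)\<^sup>2) * min 1 ((norm z)\<^sup>2)" for z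
      proof -
        have "norm (J s z) \<le> (2 + s\<^sup>2 * (norm T)\<^sup>2) * min 1 ((norm z)\<^sup>2)"
          using norm_levy_integrand_le[of z "s *\<^sub>R T"] by (simp add: J_def power_mult_distrib)
        also have "\<dots> \<le> (s\<^sup>2 * (2 + (norm T)\<^sup>2)) * min 1 ((norm z)\<^sup>2)"
          using elim by (intro mult_right_mono) (auto simp: algebra_simps)
        finally show ?thesis using elim by (simp add: norm_divide norm_power divide_simps algebra_simps)
      qed
      then show ?case by simp
    qed
    show "AE z in \<nu>. ((\<lambda>s. J s z / complex_of_real (s\<^sup>2)) \<longlongrightarrow> 0) at_top"
    proof (rule AE_I2)
      fix z
      \<comment> \<open>For fixed \<open>z\<close> the integrand grows at most linearly, like
        \<open>2 + s * c\<close>, and loses against \<open>s\<^sup>2\<close>.\<close>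
      define c where "c = \<bar>inner z T\<bar>"
      show "((\<lambda>s. J s z / complex_of_real (s\<^sup>2)) \<longlongrightarrow> 0) at_top"
      proof (rule Lim_null_comparison)
        have "((\<lambda>s. 2 / s\<^sup>2 + c / s) \<longlongrightarrow> 0 + 0) at_top"
          by (intro tendsto_add real_tendsto_divide_at_top[OF tendsto_const]
              filterlim_pow_at_top filterlim_ident) simp
        then show "((\<lambda>s. 2 / s\<^sup>2 + c / s) \<longlongrightarrow> 0) at_top" by simp
        show "\<forall>\<^sub>F s in at_top. norm (J s z / complex_of_real (s\<^sup>2)) \<le> 2 / s\<^sup>2 + c / s"
          using eventually_gt_at_top[of 0]
        proof eventually_elim
          case (elim s)
          have "norm (J s z) \<le> (norm (iexp (inner z (s *\<^sub>R T))) + norm (1::complex)) + s * c"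
            unfolding J_def
            by (intro order_trans[OF norm_triangle_ineq4] add_mono norm_triangle_ineq4)
               (use elim in \<open>auto simp: norm_mult abs_mult c_def indicator_def\<close>)
          also have "\<dots> = 2 + s * c" by simp
          finally have "norm (J s z) / s\<^sup>2 \<le> (2 + s * c) / s\<^sup>2"
            by (rule divide_right_mono) simp
          also have "\<dots> = 2 / s\<^sup>2 + c / s" using elim by (simp add: field_simps power2_eq_square)
          finally show ?case by (simp add: norm_divide norm_power)
        qed
      qed
    qed
  qed simp
  have "((\<lambda>s. \<i> * complex_of_real (inner D T / s) - complex_of_real (inner (Q T) T) / 2
      + (CLINT z|\<nu>. J s z / complex_of_real (s\<^sup>2)))
      \<longlongrightarrow> \<i> * complex_of_real 0 - complex_of_real (inner (Q T) T) / 2 + (CLINT z|\<nu>. 0)) at_top"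
    by (intro tendsto_add tendsto_diff tendsto_mult tendsto_of_real tendsto_const lim
        real_tendsto_divide_at_top[OF tendsto_const filterlim_ident])
  then show ?thesis
  proof (rule Lim_transform_eventually[THEN tendsto_eq_rhs])
    show "\<forall>\<^sub>F s in at_top. \<i> * complex_of_real (inner D T / s) - complex_of_real (inner (Q T) T) / 2
        + (CLINT z|\<nu>. J s z / complex_of_real (s\<^sup>2))
        = levy_exponent D Q \<nu> (s *\<^sub>R T) / complex_of_real (s\<^sup>2)"
      using eventually_gt_at_top[of 0]
    proof eventually_elim
      case (elim s)
      then show ?case
        unfolding levy_exponent_def J_def[symmetric] linear_scale[OF Q]
        by (simp add: field_simps power2_eq_square)
    qed
  qed simp
qed

section \<open>Nonnegative projections have no Gaussian part\<close>

text \<open>The normal density is strictly positive, so its null sets are Lebesgue null, whereas the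
  half-line contains an interval of length 1.\<close>

lemma std_normal_measure_atMost_pos: "0 < measure std_normal_distribution {..x}"
proof -
  interpret real_distribution std_normal_distribution by (rule real_dist_normal_dist)
  have "{..x} \<notin> null_sets lborel"
  proof
    assume "{..x} \<in> null_sets lborel"
    then have "{x - 1..x} \<in> null_sets lborel" by (rule null_sets_subset) auto
    then have "emeasure lborel {x - 1..x} = 0" by (rule null_setsD1)
    then show False by simp
  qed
  moreover have "{..x} \<in> null_sets std_normal_distribution \<longleftrightarrow> {..x} \<in> null_sets lborel"
  proof -
    have "(AE y in lborel. y \<in> {..x} \<longrightarrow> ennreal (std_normal_density y) = 0)
        \<longleftrightarrow> (AE y in lborel. y \<notin> {..x})"
      by (intro AE_cong) (auto simp: ennreal_eq_0_iff not_le[THEN iffD2, OF normal_density_pos])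
    then show ?thesis
      by (subst null_sets_density_iff) (auto simp: AE_iff_null_sets)
  qed
  ultimately show ?thesis
    by (simp add: null_sets_def zero_less_measure_iff emeasure_eq_measure)
qed

lemma levy_khintchine_gaussian_part_eq_0:
  fixes X :: "real \<Rightarrow> 'w \<Rightarrow> 'b::{real_inner, second_countable_topology}"
  assumes "prob_space M" and X: "\<And>t. 0 \<le> t \<Longrightarrow> X t \<in> borel_measurable M"
    and triplet: "levy_khintchine_triplet M X D Q \<nu>"
    and nonneg: "\<And>t. 0 \<le> t \<Longrightarrow> AE \<omega> in M. 0 \<le> inner (X t \<omega>) T"
  shows "inner (Q T) T = 0"
proof (rule ccontr)
  interpret prob_space M by fact
  have Q: "bounded_linear Q" and Qnn: "nonneg_definite Q" and \<nu>: "levy_measure \<nu>"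
    and char: "\<And>t S. 0 \<le> t \<Longrightarrow> (CLINT \<omega>|M. iexp (inner (X t \<omega>) S))
      = exp (complex_of_real t * levy_exponent D Q \<nu> S)"
    using triplet by (auto simp: levy_khintchine_triplet_def)
  interpret Q: bounded_linear Q by fact
  assume "inner (Q T) T \<noteq> 0"
  then have q: "0 < inner (Q T) T" using Qnn by (simp add: nonneg_definite_def less_le)
  \<comment> \<open>Normalised to unit variance, so that the limit law is the standard normal one;
    the positive factor preserves the sign of the projection.\<close>
  define U where "U = (1 / sqrt (inner (Q T) T)) *\<^sub>R T"
  have QU: "inner (Q U) U = 1" using q by (simp add: U_def Q.scaleR)
  \<comment> \<open>With \<open>t = 1 / Suc n\<close> this is \<open>1 / sqrt t\<close>, so the time
    factor in the characteristic function of \<open>Y n\<close> becomes division by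
    \<open>(s n)\<^sup>2\<close>. Using \<open>Suc\<close> keeps \<open>t\<close> defined at
    \<open>n = 0\<close>.\<close>
  define s where "s n = sqrt (real (Suc n))" for n
  have s: "0 < s n" "(s n)\<^sup>2 = real (Suc n)" for n by (simp_all add: s_def)
  have s_top: "filterlim s at_top sequentially"
    unfolding s_def by (rule filterlim_compose[OF sqrt_at_top])
      (rule filterlim_compose[OF filterlim_real_sequentially filterlim_Suc])
  define Y where "Y n \<omega> = s n * inner (X (1 / real (Suc n)) \<omega>) U" for n \<omega>
  have [measurable]: "X (1 / real (Suc n)) \<in> borel_measurable M" for n by (rule X) simp
  have Ym[measurable]: "Y n \<in> borel_measurable M" for n unfolding Y_def by measurable
  have Y: "AE \<omega> in M. 0 \<le> Y n \<omega>" for n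
  proof -
    have "AE \<omega> in M. 0 \<le> inner (X (1 / real (Suc n)) \<omega>) T" by (rule nonneg) simp
    then show ?thesis
    proof eventually_elim
      case (elim \<omega>)
      then show ?case using q s(1)[of n] by (simp add: Y_def U_def)
    qed
  qed
  define \<mu> where "\<mu> n = distr M borel (Y n)" for n
  have \<mu>: "real_distribution (\<mu> n)" for n unfolding \<mu>_def by (rule real_distribution_distr) (rule Ym)
  have "weak_conv_m \<mu> std_normal_distribution"
  proof (rule levy_continuity[OF \<mu> real_dist_normal_dist])
    fix w :: real
    have eq: "char (\<mu> n) w = exp (levy_exponent D Q \<nu> (s n *\<^sub>R w *\<^sub>R U) / complex_of_real ((s n)\<^sup>2))" for n
    proof -
      have "char (\<mu> n) w = (CLINT \<omega>|M. iexp (w * Y n \<omega>))"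
        unfolding char_def \<mu>_def by (rule integral_distr) measurable
      also have "\<dots> = (CLINT \<omega>|M. iexp (inner (X (1 / real (Suc n)) \<omega>) (s n *\<^sub>R w *\<^sub>R U)))"
        by (simp add: Y_def mult_ac)
      also have "\<dots> = exp (complex_of_real (1 / real (Suc n)) * levy_exponent D Q \<nu> (s n *\<^sub>R w *\<^sub>R U))"
        by (rule char) simp
      finally show ?thesis unfolding s(2) by simp
    qed
    have "(\<lambda>n. levy_exponent D Q \<nu> (s n *\<^sub>R w *\<^sub>R U) / complex_of_real ((s n)\<^sup>2))
        \<longlonglongrightarrow> - complex_of_real (inner (Q (w *\<^sub>R U)) (w *\<^sub>R U)) / 2"
      by (rule filterlim_compose[OF tendsto_levy_exponent_scaled[OF Q.linear \<nu>] s_top])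
    then have "(\<lambda>n. char (\<mu> n) w)
        \<longlonglongrightarrow> exp (- complex_of_real (inner (Q (w *\<^sub>R U)) (w *\<^sub>R U)) / 2)"
      unfolding eq by (rule tendsto_exp)
    moreover have "exp (- complex_of_real (inner (Q (w *\<^sub>R U)) (w *\<^sub>R U)) / 2)
        = char std_normal_distribution w"
      by (simp add: char_std_normal_distribution exp_of_real[symmetric] Q.scaleR QU power2_eq_square)
    ultimately show "(\<lambda>n. char (\<mu> n) w) \<longlonglongrightarrow> char std_normal_distribution w" by simp
  qed
  \<comment> \<open>Weak convergence yields convergence of distribution functions only at continuity
    points; the normal law has no atoms.\<close>
  moreover have "isCont (cdf std_normal_distribution) (- 1)"
  proof -
    interpret N: real_distribution std_normal_distribution by (rule real_dist_normal_dist)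
    have "{- 1} \<in> null_sets std_normal_distribution"
    proof (subst null_sets_density_iff)
      have "AE x in lborel. x \<in> {- 1} \<longrightarrow> ennreal (std_normal_density x) = 0"
        using AE_lborel_singleton[of "- 1 :: real"] by eventually_elim simp
      then show "{- 1} \<in> sets lborel \<and> (AE x in lborel. x \<in> {- 1} \<longrightarrow> ennreal (std_normal_density x) = 0)"
        by (rule conjI[rotated]) simp
    qed simp
    then show ?thesis unfolding N.isCont_cdf by (simp add: measure_eq_0_null_sets)
  qed
  ultimately have "(\<lambda>n. cdf (\<mu> n) (- 1)) \<longlonglongrightarrow> cdf std_normal_distribution (- 1)"
    by (simp add: weak_conv_m_def weak_conv_def)
  \<comment> \<open>Each \<open>Y n\<close> is almost surely nonnegative and puts no mass below
    \<open>-1\<close>, whereas the limit law does.\<close>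
  moreover have "cdf (\<mu> n) (- 1) = 0" for n
  proof -
    have "cdf (\<mu> n) (- 1) = prob {\<omega> \<in> space M. Y n \<omega> \<le> - 1}"
      unfolding cdf_def \<mu>_def by (subst measure_distr) (auto intro!: arg_cong[where f = prob])
    also have "\<dots> = 0"
    proof (subst prob_Collect_eq_0)
      show "AE \<omega> in M. \<not> Y n \<omega> \<le> - 1" using Y[of n] by eventually_elim simp
    qed measurable
    finally show ?thesis .
  qed
  ultimately have "cdf std_normal_distribution (- 1) = 0"
    by (simp add: LIMSEQ_const_iff)
  then show False using std_normal_measure_atMost_pos[of "- 1"] by (simp add: cdf_def)
qed

theorem proposition2p10:
  fixes M :: "'w measure"
    and L :: "real \<Rightarrow> 'w \<Rightarrow> 'h::separable_hilbert_space hs"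
    and D :: "'h hs" and Q0 :: "'h hs \<Rightarrow> 'h hs" and \<nu> :: "'h hs measure"
    and T :: "'h hs"
  assumes "levy_process M L"
    and "square_integrable_process M L"
    and "nondecreasing_paths M L"
    and "levy_khintchine_triplet M L D Q0 \<nu>"
    and "self_adjoint (hs_apply T)"
  shows "Q0 T = 0"
proof -
  interpret L: levy_process M L by fact
  have Q: "linear Q0" "self_adjoint Q0" "nonneg_definite Q0"
    using assms(4) by (auto simp: levy_khintchine_triplet_def bounded_linear.linear)
  \<comment> \<open>A path starting at zero with nondecreasing quadratic form has a nonnegative form
    at every later time.\<close>
  have pos: "AE \<omega> in M. 0 \<le> inner (L t \<omega>) (rank_one f)" if "0 \<le> t" for t and f :: 'h
    using assms(3)[unfolded nondecreasing_paths_def] L.starts_at_0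
  proof eventually_elim
    case (elim \<omega>)
    then have "mono_on {0..} (\<lambda>t. inner (hs_apply (L t \<omega>) f) f)" by blast
    then have "inner (hs_apply (L 0 \<omega>) f) f \<le> inner (hs_apply (L t \<omega>) f) f"
      by (rule mono_onD) (use that in auto)
    with elim show ?case by (simp add: inner_rank_one zero_hs.rep_eq)
  qed
  have "Q0 (rank_one f) = 0" for f
    by (rule nonneg_definite_inner_eq_0D[OF Q
          levy_khintchine_gaussian_part_eq_0[OF L.prob_space_axioms L.measurable_X assms(4) pos]])
  \<comment> \<open>Self-adjointness moves \<open>Q0\<close> from \<open>T\<close> onto
    \<open>rank_one f\<close>, where it vanishes.\<close>
  then have "inner (hs_apply (Q0 T) f) f = 0" for f
    using Q(2) by (simp add: inner_rank_one[symmetric] self_adjoint_def)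
  then have "inner (Q0 T) T = 0"
    using assms(5) by (rule inner_hs_antisymmetric_self_adjoint)
  then show ?thesis by (rule nonneg_definite_inner_eq_0D[OF Q])
qed

end
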